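(* There exists no elliptic curve $E$ over $\mathbb{Q}$ that has a $\mathbb{Q}$-rational point of order $12$ and whose conductor is $N_E=p^{\alpha}q^{\beta}$, where $p\neq q$ are primes and $\alpha,\beta>0$ are integers.
   Context: For an elliptic curve $E/\mathbb{Q}$, $N_E$ denotes its conductor. *)

theory Defs
  imports Complex_Main "HOL-Computational_Algebra.Computational_Algebra"
    "HOL-Algebra.Ideal_Product" "HOL-Library.FuncSet"
begin

section \<open>Weierstrass equations\<close>

text \<open>An elliptic curve over a field is given by a generalised Weierstrass equation
  \<open>y^2 + a1 x y + a3 y = x^3 + a2 x^2 + a4 x + a6\<close> with nonzero discriminant.\<close>

datatype 'a weierstrass = Weierstrass (a1: 'a) (a2: 'a) (a3: 'a) (a4: 'a) (a6: 'a)

definition b2 :: "'a::comm_ring_1 weierstrass \<Rightarrow> 'a" where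
  "b2 E = a1 E ^ 2 + 4 * a2 E"

definition b4 :: "'a::comm_ring_1 weierstrass \<Rightarrow> 'a" where
  "b4 E = 2 * a4 E + a1 E * a3 E"

definition b6 :: "'a::comm_ring_1 weierstrass \<Rightarrow> 'a" where
  "b6 E = a3 E ^ 2 + 4 * a6 E"

definition b8 :: "'a::comm_ring_1 weierstrass \<Rightarrow> 'a" where
  "b8 E = a1 E ^ 2 * a6 E + 4 * a2 E * a6 E - a1 E * a3 E * a4 E + a2 E * a3 E ^ 2 - a4 E ^ 2"

definition discriminant :: "'a::comm_ring_1 weierstrass \<Rightarrow> 'a" where
  "discriminant E = - (b2 E ^ 2 * b8 E) - 8 * b4 E ^ 3 - 27 * b6 E ^ 2 + 9 * b2 E * b4 E * b6 E"

definition elliptic_curve :: "'a::field weierstrass \<Rightarrow> bool" where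
  "elliptic_curve E \<longleftrightarrow> discriminant E \<noteq> 0"

text \<open>The substitution \<open>x = u^2 x' + r\<close>, \<open>y = u^3 y' + s u^2 x' + t\<close> carries
  the equation \<open>E\<close> (in \<open>x\<close>, \<open>y\<close>) to the equation \<open>E'\<close> (in \<open>x'\<close>, \<open>y'\<close>).\<close>

definition change_of_variables ::
    "'a::field \<Rightarrow> 'a \<Rightarrow> 'a \<Rightarrow> 'a \<Rightarrow> 'a weierstrass \<Rightarrow> 'a weierstrass \<Rightarrow> bool" where
  "change_of_variables u r s t E E' \<longleftrightarrow>
     u * a1 E' = a1 E + 2 * s \<and>
     u ^ 2 * a2 E' = a2 E - s * a1 E + 3 * r - s ^ 2 \<and>
     u ^ 3 * a3 E' = a3 E + r * a1 E + 2 * t \<and>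
     u ^ 4 * a4 E' = a4 E - s * a3 E + 2 * r * a2 E - (t + r * s) * a1 E + 3 * r ^ 2 - 2 * s * t \<and>
     u ^ 6 * a6 E' = a6 E + r * a4 E + r ^ 2 * a2 E + r ^ 3 - t * a3 E - t ^ 2 - r * t * a1 E"

definition isomorphic :: "'a::field weierstrass \<Rightarrow> 'a weierstrass \<Rightarrow> bool" where
  "isomorphic E E' \<longleftrightarrow> (\<exists>u r s t. u \<noteq> 0 \<and> change_of_variables u r s t E E')"


section \<open>The group law\<close>

datatype 'a point = Infinity | Affine 'a 'a

definition points :: "'a::field weierstrass \<Rightarrow> 'a point set" where
  "points E = {Infinity} \<union>
     {Affine x y | x y.
        y ^ 2 + a1 E * x * y + a3 E * y = x ^ 3 + a2 E * x ^ 2 + a4 E * x + a6 E}"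

fun point_add :: "'a::field weierstrass \<Rightarrow> 'a point \<Rightarrow> 'a point \<Rightarrow> 'a point" where
  "point_add E Infinity Q = Q"
| "point_add E P Infinity = P"
| "point_add E (Affine x1 y1) (Affine x2 y2) =
     (if x1 = x2 \<and> y1 + y2 + a1 E * x2 + a3 E = 0 then Infinity
      else
        let l = (if x1 = x2
                 then (3 * x1 ^ 2 + 2 * a2 E * x1 + a4 E - a1 E * y1) / (2 * y1 + a1 E * x1 + a3 E)
                 else (y2 - y1) / (x2 - x1));
            n = y1 - l * x1;
            x3 = l ^ 2 + a1 E * l - a2 E - x1 - x2
        in Affine x3 (- (l + a1 E) * x3 - n - a3 E))"

definition point_mult :: "'a::field weierstrass \<Rightarrow> nat \<Rightarrow> 'a point \<Rightarrow> 'a point" where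
  "point_mult E n P = (point_add E P ^^ n) Infinity"

definition has_order :: "'a::field weierstrass \<Rightarrow> 'a point \<Rightarrow> nat \<Rightarrow> bool" where
  "has_order E P n \<longleftrightarrow> 0 < n \<and> point_mult E n P = Infinity \<and>
     (\<forall>m. 0 < m \<and> m < n \<longrightarrow> point_mult E m P \<noteq> Infinity)"


section \<open>Reduction of an elliptic curve over the rationals\<close>

definition integral_model :: "rat weierstrass \<Rightarrow> int weierstrass \<Rightarrow> bool" where
  "integral_model E V \<longleftrightarrow> isomorphic E (map_weierstrass of_int V)"

text \<open>Minimality at \<open>p\<close> only needs to be tested against models with integer (rather than
  \<open>p\<close>-integral rational) coefficients: scaling by an integer prime to \<open>p\<close> clears the other
  denominators without changing the \<open>p\<close>-adic valuation of the discriminant.\<close>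

definition minimal_model_at :: "nat \<Rightarrow> rat weierstrass \<Rightarrow> int weierstrass \<Rightarrow> bool" where
  "minimal_model_at p E V \<longleftrightarrow> integral_model E V \<and>
     (\<forall>V'. integral_model E V' \<longrightarrow>
        multiplicity (int p) (discriminant V) \<le> multiplicity (int p) (discriminant V'))"

definition good_reduction :: "rat weierstrass \<Rightarrow> nat \<Rightarrow> bool" where
  "good_reduction E p \<longleftrightarrow> (\<exists>V. minimal_model_at p E V \<and> \<not> int p dvd discriminant V)"

definition singular_mod :: "nat \<Rightarrow> int weierstrass \<Rightarrow> int \<Rightarrow> int \<Rightarrow> bool" where
  "singular_mod p V x y \<longleftrightarrow>
     int p dvd y ^ 2 + a1 V * x * y + a3 V * y - (x ^ 3 + a2 V * x ^ 2 + a4 V * x + a6 V) \<and>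
     int p dvd a1 V * y - (3 * x ^ 2 + 2 * a2 V * x + a4 V) \<and>
     int p dvd 2 * y + a1 V * x + a3 V"

text \<open>The slopes of the tangents at a singular point with abscissa \<open>x\<close> are the roots of
  \<open>T^2 + a1 T - (a2 + 3 x)\<close> in an algebraic closure of the residue field; the point is a node
  if they are distinct, i.e. if the discriminant of this polynomial is nonzero.
  The singular point is unique, hence rational over the (perfect) residue field.\<close>

definition node_mod :: "nat \<Rightarrow> int weierstrass \<Rightarrow> int \<Rightarrow> int \<Rightarrow> bool" where
  "node_mod p V x y \<longleftrightarrow> singular_mod p V x y \<and> \<not> int p dvd a1 V ^ 2 + 4 * (a2 V + 3 * x)"

definition multiplicative_reduction :: "rat weierstrass \<Rightarrow> nat \<Rightarrow> bool" where
  "multiplicative_reduction E p \<longleftrightarrow> (\<exists>V. minimal_model_at p E V \<and> (\<exists>x y. node_mod p V x y))"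


section \<open>The wild part of the conductor exponent\<close>

text \<open>Let \<open>l \<noteq> p\<close> be a prime, \<open>L = \<rat>(E[l])\<close>, and let \<open>\<PP>\<close> be a prime of \<open>L\<close> above \<open>p\<close>.
  The wild part of the exponent at \<open>p\<close> is
  \<open>\<delta> = \<Sum>i\<ge>1. |G i| / |G 0| * dim (E[l] / E[l]^(G i))\<close>, with \<open>dim\<close> over the field of
  \<open>l\<close> elements and \<open>G i\<close> the ramification groups in lower numbering. These groups are computed
  globally, as subgroups of the Galois group of \<open>L\<close>: this gives the ramification groups of the
  completion of \<open>L\<close> at \<open>\<PP>\<close>, which is generated over the \<open>p\<close>-adic numbers by \<open>E[l]\<close>.\<close>

definition complex_curve :: "rat weierstrass \<Rightarrow> complex weierstrass" where
  "complex_curve E = map_weierstrass of_rat E"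

definition torsion :: "rat weierstrass \<Rightarrow> nat \<Rightarrow> complex point set" where
  "torsion E l = {P \<in> points (complex_curve E). point_mult (complex_curve E) l P = Infinity}"

definition subfield_complex :: "complex set \<Rightarrow> bool" where
  "subfield_complex K \<longleftrightarrow>
     1 \<in> K \<and> (\<forall>x\<in>K. \<forall>y\<in>K. x - y \<in> K \<and> x * y \<in> K) \<and> (\<forall>x\<in>K. inverse x \<in> K)"

definition torsion_field :: "rat weierstrass \<Rightarrow> nat \<Rightarrow> complex set" where
  "torsion_field E l = subfield_complex hull (\<Union>P\<in>torsion E l. set_point P)"

definition field_automorphisms :: "complex set \<Rightarrow> (complex \<Rightarrow> complex) set" where
  "field_automorphisms K = {\<sigma> \<in> extensional K. bij_betw \<sigma> K K \<and>
     (\<forall>x\<in>K. \<forall>y\<in>K. \<sigma> (x + y) = \<sigma> x + \<sigma> y \<and> \<sigma> (x * y) = \<sigma> x * \<sigma> y)}"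

definition integer_ring :: "complex set \<Rightarrow> complex ring" where
  "integer_ring K = \<lparr>carrier = {x \<in> K. algebraic_int x}, mult = (*), one = 1,
     zero = 0, add = (+)\<rparr>"

definition prime_above :: "complex set \<Rightarrow> nat \<Rightarrow> complex set \<Rightarrow> bool" where
  "prime_above K p PP \<longleftrightarrow> primeideal PP (integer_ring K) \<and> of_nat p \<in> PP"

definition ideal_power :: "complex set \<Rightarrow> complex set \<Rightarrow> nat \<Rightarrow> complex set" where
  "ideal_power K I n = (ideal_prod (integer_ring K) I ^^ n) (carrier (integer_ring K))"

definition ramification_group ::
    "complex set \<Rightarrow> complex set \<Rightarrow> nat \<Rightarrow> (complex \<Rightarrow> complex) set" where
  "ramification_group K PP i = {\<sigma> \<in> field_automorphisms K.
     \<forall>x \<in> carrier (integer_ring K). \<sigma> x - x \<in> ideal_power K PP (Suc i)}"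

definition torsion_fixed ::
    "rat weierstrass \<Rightarrow> nat \<Rightarrow> (complex \<Rightarrow> complex) set \<Rightarrow> complex point set" where
  "torsion_fixed E l G = {P \<in> torsion E l. \<forall>\<sigma>\<in>G. map_point \<sigma> P = P}"

text \<open>All summands with large index vanish, because the ramification groups are eventually
  trivial. The dimension of a finite vector space over the field with \<open>l\<close> elements is the
  logarithm to base \<open>l\<close> of its cardinality.\<close>

definition wild_exponent_aux :: "rat weierstrass \<Rightarrow> nat \<Rightarrow> complex set \<Rightarrow> real" where
  "wild_exponent_aux E l PP =
     (let G = ramification_group (torsion_field E l) PP in
      \<Sum>i. real (card (G (Suc i))) / real (card (G 0)) *
          log (real l) (real (card (torsion E l)) / real (card (torsion_fixed E l (G (Suc i))))))"

text \<open>The value depends neither on the choice of the prime \<open>l \<noteq> p\<close> nor on that of the prime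
  above \<open>p\<close>, and it is a nonnegative integer, hence taking the floor changes nothing.\<close>

definition wild_exponent :: "rat weierstrass \<Rightarrow> nat \<Rightarrow> nat" where
  "wild_exponent E p =
     (let l = (if p = 2 then 3 else 2);
          PP = (SOME PP. prime_above (torsion_field E l) p PP)
      in nat \<lfloor>wild_exponent_aux E l PP\<rfloor>)"


section \<open>The conductor\<close>

definition conductor_exponent :: "rat weierstrass \<Rightarrow> nat \<Rightarrow> nat" where
  "conductor_exponent E p =
     (if good_reduction E p then 0
      else if multiplicative_reduction E p then 1
      else 2 + wild_exponent E p)"

text \<open>Only finitely many primes have a nonzero exponent.\<close>

definition conductor :: "rat weierstrass \<Rightarrow> nat" where
  "conductor E =
     (\<Prod>p | prime p \<and> conductor_exponent E p \<noteq> 0. p ^ conductor_exponent E p)"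

end

theory Submission
  imports Defs
begin

text \<open>A point \<open>P\<close> of order \<open>12\<close> can be moved to the origin of a Tate normal form
  \<open>y^2 + (1 - c) x y - b y = x^3 - b x^2\<close>, and solving \<open>6 P = - 6 P\<close> shows that \<open>b\<close> and \<open>c\<close>
  are rational functions of one parameter \<open>v = m / k\<close> in lowest terms. The primes dividing
  \<open>m k (m + k) (m - k) (m^2 + k^2)\<close> reduce \<open>v\<close> to a cusp; they are bad because the
  \<open>j\<close>-invariant \<open>c4^3 / \<Delta>\<close> is not integral there. The product \<open>m k (m + k) (m - k)\<close>
  is always divisible by \<open>6\<close>, so \<open>2\<close> and \<open>3\<close> are bad. The sum of two coprime squares
  \<open>m^2 + k^2\<close> is divisible neither by \<open>3\<close> nor by \<open>4\<close>, and it exceeds \<open>2\<close> since \<open>v\<close> is not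
  \<open>0\<close>, \<open>1\<close> or \<open>-1\<close>, so it yields a third bad prime, whereas the conductor \<open>p^\<alpha> q^\<beta>\<close> only
  allows two.\<close>

section \<open>The j-invariant and bad reduction\<close>

definition c4 :: "'a::comm_ring_1 weierstrass \<Rightarrow> 'a" where
  "c4 E = b2 E ^ 2 - 24 * b4 E"

section \<open>Transformation of \<open>c4\<close> and the discriminant\<close>

lemma b_relation: "4 * b8 E = b2 E * b6 E - b4 E ^ 2"
  unfolding b2_def b4_def b6_def b8_def by (simp add: algebra_simps power2_eq_square)

text \<open>The defining equations are solved for the coefficients of \<open>E\<close>, so that
  later identities become polynomial identities in \<open>E'\<close>, \<open>u\<close>,
  \<open>r\<close>, \<open>s\<close>, \<open>t\<close> by rewriting alone.\<close>

lemma change_of_variables_coefficients: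
  assumes "change_of_variables u r s t E E'"
  shows "a1 E = u * a1 E' - 2 * s"
    and "a2 E = u ^ 2 * a2 E' + s * (u * a1 E' - 2 * s) - 3 * r + s ^ 2"
    and "a3 E = u ^ 3 * a3 E' - r * (u * a1 E' - 2 * s) - 2 * t"
    and "a4 E = u ^ 4 * a4 E' + s * a3 E - 2 * r * a2 E + (t + r * s) * a1 E - 3 * r ^ 2 + 2 * s * t"
    and "a6 E = u ^ 6 * a6 E' - r * a4 E - r ^ 2 * a2 E - r ^ 3 + t * a3 E + t ^ 2 + r * t * a1 E"
  using assms unfolding change_of_variables_def by (simp_all add: algebra_simps)

lemma change_of_variables_b:
  fixes E E' :: "'a::field weierstrass"
  assumes "change_of_variables u r s t E E'"
  shows "b2 E = u ^ 2 * b2 E' - 12 * r"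
    and "b4 E = u ^ 4 * b4 E' - r * u ^ 2 * b2 E' + 6 * r ^ 2"
    and "b6 E = u ^ 6 * b6 E' - 2 * r * u ^ 4 * b4 E' + r ^ 2 * u ^ 2 * b2 E' - 4 * r ^ 3"
    and "b8 E = u ^ 8 * b8 E' - 3 * r * u ^ 6 * b6 E' + 3 * r ^ 2 * u ^ 4 * b4 E'
      - r ^ 3 * u ^ 2 * b2 E' + 3 * r ^ 4"
  unfolding b2_def b4_def b6_def b8_def change_of_variables_coefficients[OF assms]
  by Groebner_Basis.algebra+

lemma change_of_variables_c4:
  assumes "change_of_variables u r s t E E'"
  shows "c4 E = u ^ 4 * c4 E'"
  unfolding c4_def change_of_variables_b[OF assms] by Groebner_Basis.algebra

lemma change_of_variables_discriminant:
  assumes "change_of_variables u r s t E E'"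
  shows "discriminant E = u ^ 12 * discriminant E'"
proof -
  \<comment> \<open>With \<open>b2\<close>, \<open>b4\<close>, \<open>b6\<close>, \<open>b8\<close>
    treated as independent, the transformation law fails; the error is a multiple of the relation
    \<open>b_relation\<close>.\<close>
  have "discriminant E = u ^ 12 * discriminant E' + (6 * r * u ^ 2 * b2 E' - 36 * r ^ 2) * u ^ 8 *
      (4 * b8 E' - (b2 E' * b6 E' - b4 E' ^ 2))"
    unfolding discriminant_def change_of_variables_b[OF assms] by Groebner_Basis.algebra
  then show ?thesis
    by (simp add: b_relation)
qed

lemma of_int_c4: "c4 (map_weierstrass of_int V) = (of_int (c4 V) :: 'a::comm_ring_1)"
  by (cases V) (simp add: c4_def b2_def b4_def)

lemma of_int_discriminant:
  "discriminant (map_weierstrass of_int V) = (of_int (discriminant V) :: 'a::comm_ring_1)"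
  by (cases V) (simp add: discriminant_def b2_def b4_def b6_def b8_def)

text \<open>Changing the model divides \<open>c4 ^ 3\<close> and the discriminant by the same power
  \<open>u ^ 12\<close>, so their quotient j is an invariant of \<open>E\<close>. The
  cross-multiplied form stays inside the integers.\<close>

lemma integral_models_j_invariant:
  assumes "integral_model E V" "integral_model E W"
  shows "c4 V ^ 3 * discriminant W = c4 W ^ 3 * discriminant V"
proof -
  obtain u r s t where u: "u \<noteq> 0" and "change_of_variables u r s t E (map_weierstrass of_int V)"
    using assms(1) unfolding integral_model_def isomorphic_def by blast
  then have V: "c4 E = u ^ 4 * of_int (c4 V)" "discriminant E = u ^ 12 * of_int (discriminant V)"
    by (simp_all flip: of_int_c4 of_int_discriminant
      add: change_of_variables_c4 change_of_variables_discriminant)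
  obtain u' r' s' t' where u': "u' \<noteq> 0"
      and "change_of_variables u' r' s' t' E (map_weierstrass of_int W)"
    using assms(2) unfolding integral_model_def isomorphic_def by blast
  then have W: "c4 E = u' ^ 4 * of_int (c4 W)" "discriminant E = u' ^ 12 * of_int (discriminant W)"
    by (simp_all flip: of_int_c4 of_int_discriminant
      add: change_of_variables_c4 change_of_variables_discriminant)
  have "(u * u') ^ 12 * of_int (c4 V ^ 3 * discriminant W) =
      (u ^ 4 * of_int (c4 V)) ^ 3 * (u' ^ 12 * of_int (discriminant W))"
    by (simp add: power_mult_distrib flip: power_mult)
  also have "\<dots> = (u' ^ 4 * of_int (c4 W)) ^ 3 * (u ^ 12 * of_int (discriminant V))"
    by (simp only: V[symmetric] W[symmetric])
  also have "\<dots> = (u * u') ^ 12 * of_int (c4 W ^ 3 * discriminant V)"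
    by (simp add: power_mult_distrib flip: power_mult)
  finally have "(of_int (c4 V ^ 3 * discriminant W) :: rat) = of_int (c4 W ^ 3 * discriminant V)"
    using u u' by simp
  then show ?thesis
    by (simp only: of_int_eq_iff)
qed

text \<open>A model whose discriminant is prime to \<open>p\<close> would make j integral at
  \<open>p\<close>. Since j is the same for all models, \<open>V\<close> may be far from
  minimal.\<close>

lemma bad_reduction_if_j_not_integral:
  assumes "prime p" "integral_model E V"
    and "int p ^ n dvd discriminant V" "\<not> int p ^ n dvd c4 V ^ 3"
  shows "\<not> good_reduction E p"
proof
  assume "good_reduction E p"
  then obtain W where W: "integral_model E W" "\<not> int p dvd discriminant W"
    unfolding good_reduction_def minimal_model_at_def by blast
  have "int p ^ n dvd c4 V ^ 3 * discriminant W"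
    unfolding integral_models_j_invariant[OF assms(2) W(1)] using assms(3) by simp
  moreover have "coprime (int p ^ n) (discriminant W)"
    using W(2) assms(1) by (simp add: prime_imp_coprime)
  ultimately show False
    using assms(4) by (simp add: coprime_dvd_mult_left_iff)
qed

text \<open>With \<open>a4 = a6 = 0\<close>, the invariants \<open>b4\<close>, \<open>b6\<close> and
  \<open>b8\<close> are multiples of \<open>a3\<close>. Modulo \<open>p\<close> the discriminant
  therefore vanishes, while \<open>c4\<close> becomes the square of
  \<open>A1 ^ 2 + 4 * A2\<close>.\<close>

lemma bad_reduction_if_a3_dvd:
  assumes "prime p" "integral_model E (Weierstrass A1 A2 A3 0 0)"
    and "int p dvd A3" "\<not> int p dvd A1 ^ 2 + 4 * A2"
  shows "\<not> good_reduction E p"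
proof (rule bad_reduction_if_j_not_integral[OF assms(1,2), where n = 1])
  obtain k where k: "A3 = int p * k"
    using assms(3) by blast
  show "int p ^ 1 dvd discriminant (Weierstrass A1 A2 A3 0 0)"
    by (simp add: discriminant_def b2_def b4_def b6_def b8_def k power_mult_distrib
        power2_eq_square power3_eq_cube)
  have "c4 (Weierstrass A1 A2 A3 0 0) = (A1 ^ 2 + 4 * A2) ^ 2 - int p * (24 * A1 * k)"
    by (simp add: c4_def b2_def b4_def k)
  then show "\<not> int p ^ 1 dvd c4 (Weierstrass A1 A2 A3 0 0) ^ 3"
    using assms(1,4) by (simp add: prime_dvd_power_iff dvd_diff_left_iff)
qed

lemma isomorphic_rescale:
  assumes "isomorphic E (Weierstrass A1 A2 A3 A4 A6)" "w \<noteq> 0"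
  shows "isomorphic E (Weierstrass (w * A1) (w ^ 2 * A2) (w ^ 3 * A3) (w ^ 4 * A4) (w ^ 6 * A6))"
proof -
  obtain u r s t where "u \<noteq> 0" "change_of_variables u r s t E (Weierstrass A1 A2 A3 A4 A6)"
    using assms(1) unfolding isomorphic_def by blast
  with assms(2) have "u / w \<noteq> 0" and
    "change_of_variables (u / w) r s t E
      (Weierstrass (w * A1) (w ^ 2 * A2) (w ^ 3 * A3) (w ^ 4 * A4) (w ^ 6 * A6))"
    by (simp_all add: change_of_variables_def power_divide)
  then show ?thesis
    unfolding isomorphic_def by blast
qed

section \<open>Tate normal form\<close>

fun transform_point :: "'a::field \<Rightarrow> 'a \<Rightarrow> 'a \<Rightarrow> 'a \<Rightarrow> 'a point \<Rightarrow> 'a point" where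
  "transform_point u r s t Infinity = Infinity"
| "transform_point u r s t (Affine x y) =
     Affine (u ^ 2 * x + r) (u ^ 3 * y + s * u ^ 2 * x + t)"

lemma transform_point_eq_Infinity_iff: "transform_point u r s t P = Infinity \<longleftrightarrow> P = Infinity"
  by (cases P) auto

text \<open>The substitution maps lines to lines and turns a slope \<open>l\<close> into
  \<open>u * l + s\<close>. Once this is known for chords and tangents, the rest is polynomial
  identities.\<close>

lemma point_add_transform:
  assumes cov: "change_of_variables u r s t E E'" and u: "u \<noteq> 0"
    and P: "P \<in> points E'" and Q: "Q \<in> points E'"
  shows "point_add E (transform_point u r s t P) (transform_point u r s t Q) =
    transform_point u r s t (point_add E' P Q)"
proof (cases "P = Infinity \<or> Q = Infinity")
  case True
  then show ?thesis
    by (cases P; cases Q) auto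
next
  case False
  then obtain x y x' y' where PQ: "P = Affine x y" "Q = Affine x' y'"
    by (meson point.exhaust)
  define X Y X' Y' where T: "X = u ^ 2 * x + r" "Y = u ^ 3 * y + s * u ^ 2 * x + t"
    "X' = u ^ 2 * x' + r" "Y' = u ^ 3 * y' + s * u ^ 2 * x' + t"
  note a = change_of_variables_coefficients[OF cov]
  have TPQ: "transform_point u r s t P = Affine X Y" "transform_point u r s t Q = Affine X' Y'"
    by (simp_all add: PQ T)
  have X: "X = X' \<longleftrightarrow> x = x'"
    unfolding T using u by simp
  have S: "Y + Y' + a1 E * X' + a3 E = u ^ 3 * (y + y' + a1 E' * x' + a3 E')" if "x = x'"
    unfolding T a that by Groebner_Basis.algebra
  show ?thesis
  proof (cases "x = x' \<and> y + y' + a1 E' * x' + a3 E' = 0")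
    case True
    then show ?thesis
      using X S unfolding TPQ unfolding PQ by simp
  next
    case ninv: False
    define l where "l = (if x = x'
      then (3 * x ^ 2 + 2 * a2 E' * x + a4 E' - a1 E' * y) / (2 * y + a1 E' * x + a3 E')
      else (y' - y) / (x' - x))"
    define L where "L = (if X = X'
      then (3 * X ^ 2 + 2 * a2 E * X + a4 E - a1 E * Y) / (2 * Y + a1 E * X + a3 E)
      else (Y' - Y) / (X' - X))"
    have L: "L = u * l + s"
    proof (cases "x = x'")
      case True
      \<comment> \<open>Two points of the curve with the same abscissa are equal or opposite. This
        guarantees that the denominator of the tangent slope, which involves only \<open>y\<close>,
        is nonzero.\<close>
      have "(y - y') * (y + y' + a1 E' * x' + a3 E') = 0"
        using P Q True unfolding PQ points_def by simp Groebner_Basis.algebra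
      then have y: "y = y'"
        using True ninv by simp
      then have nz: "2 * y + a1 E' * x + a3 E' \<noteq> 0"
        using True ninv by simp
      define A B where "A = 3 * x ^ 2 + 2 * a2 E' * x + a4 E' - a1 E' * y"
        and "B = 2 * y + a1 E' * x + a3 E'"
      have "2 * Y + a1 E * X + a3 E = u ^ 3 * B"
        unfolding B_def T a by Groebner_Basis.algebra
      moreover have "3 * X ^ 2 + 2 * a2 E * X + a4 E - a1 E * Y = u ^ 4 * A + s * u ^ 3 * B"
        unfolding A_def B_def T a by Groebner_Basis.algebra
      ultimately have "L = (u ^ 4 * A + s * u ^ 3 * B) / (u ^ 3 * B)"
        using True X by (simp add: L_def)
      also have "\<dots> = u * (A / B) + s"
        using nz u by (simp add: B_def[symmetric] add_divide_distrib eval_nat_numeral)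
      also have "A / B = l"
        using True by (simp add: A_def B_def l_def)
      finally show ?thesis .
    next
      case False
      have "X' - X = u ^ 2 * (x' - x)" "Y' - Y = u ^ 3 * (y' - y) + s * u ^ 2 * (x' - x)"
        unfolding T by Groebner_Basis.algebra+
      moreover have "x' - x \<noteq> 0"
        using False by simp
      ultimately show ?thesis
        using False X u by (simp add: L_def l_def add_divide_distrib eval_nat_numeral)
    qed
    have nINV: "\<not> (X = X' \<and> Y + Y' + a1 E * X' + a3 E = 0)"
      using ninv X S u by auto
    define x3 where "x3 = l ^ 2 + a1 E' * l - a2 E' - x - x'"
    define X3 where "X3 = L ^ 2 + a1 E * L - a2 E - X - X'"
    have 1: "point_add E' P Q = Affine x3 (- (l + a1 E') * x3 - (y - l * x) - a3 E')"
      using ninv unfolding PQ point_add.simps Let_def l_def[symmetric] x3_def by simp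
    have 2: "point_add E (Affine X Y) (Affine X' Y') =
        Affine X3 (- (L + a1 E) * X3 - (Y - L * X) - a3 E)"
      using nINV unfolding point_add.simps Let_def L_def[symmetric] X3_def by simp
    have 3: "X3 = u ^ 2 * x3 + r"
      unfolding X3_def x3_def L T a by Groebner_Basis.algebra
    have 4: "- (L + a1 E) * X3 - (Y - L * X) - a3 E =
        u ^ 3 * (- (l + a1 E') * x3 - (y - l * x) - a3 E') + s * u ^ 2 * x3 + t"
      unfolding 3 unfolding L T a by Groebner_Basis.algebra
    show ?thesis
      unfolding TPQ 1 2 4 by (simp only: 3 transform_point.simps)
  qed
qed

declare point_add.simps(3) [simp del]

section \<open>Multiples of the origin on a Tate curve\<close>

definition tate :: "'a::field \<Rightarrow> 'a \<Rightarrow> 'a weierstrass" where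
  "tate b c = Weierstrass (1 - c) (- b) (- b) 0 0"

fun tate_neg :: "'a::field \<Rightarrow> 'a \<Rightarrow> 'a point \<Rightarrow> 'a point" where
  "tate_neg b c Infinity = Infinity"
| "tate_neg b c (Affine x y) = Affine x (b - (1 - c) * x - y)"

lemma Affine_mem_tate:
  "Affine x y \<in> points (tate b c) \<longleftrightarrow> y ^ 2 + (1 - c) * x * y - b * y = x ^ 3 - b * x ^ 2"
  by (simp add: points_def tate_def)

lemma tate_neg_neg: "tate_neg b c (tate_neg b c Q) = Q"
  by (cases Q) auto

lemma tate_add_origin:
  assumes "x \<noteq> 0"
  shows "point_add (tate b c) (Affine 0 0) (Affine x y) =
    Affine ((y / x) ^ 2 + (1 - c) * (y / x) + b - x)
      (b - (y / x + 1 - c) * ((y / x) ^ 2 + (1 - c) * (y / x) + b - x))"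
proof -
  define l where "l = y / x"
  have y: "y = l * x"
    using assms by (simp add: l_def)
  show ?thesis
    using assms by (simp add: y tate_def point_add.simps(3) Let_def) (simp add: algebra_simps)
qed

lemma tate_double_origin:
  assumes "b \<noteq> 0"
  shows "point_add (tate b c) (Affine 0 0) (Affine 0 0) = Affine b (b * c)"
  using assms by (simp add: tate_def point_add.simps(3) Let_def algebra_simps)

lemma tate_add_origin_neg:
  "point_add (tate b c) (Affine 0 0) (Affine 0 b) = Infinity"
  by (simp add: tate_def point_add.simps(3))

text \<open>A point off the line \<open>x = 0\<close> is described by the slope \<open>l\<close> of
  its chord to the origin. The last equation is Vieta's rule: \<open>x\<close> and the other factor
  are the abscissae of the two further intersections of \<open>y = l * x\<close> with the
  curve.\<close>

lemma tate_point_cases: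
  assumes "Q \<in> points (tate b c)"
  obtains "Q = Infinity" | "Q = Affine 0 0" | "Q = Affine 0 b"
    | x l where "Q = Affine x (l * x)" "x \<noteq> 0" "x * (l ^ 2 + (1 - c) * l + b - x) = b * l"
proof (cases Q)
  case (Affine x y)
  show thesis
  proof (cases "x = 0")
    case True
    then have "y ^ 2 = b * y"
      using assms Affine by (simp add: Affine_mem_tate)
    then have "y = 0 \<or> y = b"
      by (simp add: power2_eq_square)
    then show thesis
      using that Affine True by auto
  next
    case False
    define l where "l = y / x"
    then have y: "y = l * x"
      using False by simp
    have "x * (x * (l ^ 2 + (1 - c) * l + b - x)) = x * (b * l)"
      using assms unfolding Affine Affine_mem_tate y by Groebner_Basis.algebra
    then show thesis
      using that(4) Affine False y by simp
  qed
qed (use that in auto)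

lemma tate_add_origin_mem:
  assumes "b \<noteq> 0" "Q \<in> points (tate b c)"
  shows "point_add (tate b c) (Affine 0 0) Q \<in> points (tate b c)"
  using assms(2)
proof (cases rule: tate_point_cases)
  case 1
  then show ?thesis
    by (simp add: Affine_mem_tate)
next
  case 2
  show ?thesis
    unfolding 2 tate_double_origin[OF assms(1)] Affine_mem_tate
    by (simp add: algebra_simps power2_eq_square power3_eq_cube)
next
  case 3
  then show ?thesis
    unfolding 3 tate_add_origin_neg by (simp add: points_def)
next
  case (4 x l)
  define x3 where "x3 = l ^ 2 + (1 - c) * l + b - x"
  \<comment> \<open>Inserting the sum into the curve equation leaves a multiple of the chord
    relation satisfied by \<open>x\<close> and \<open>l\<close>.\<close>
  have "(b - (l + 1 - c) * x3) ^ 2 + (1 - c) * x3 * (b - (l + 1 - c) * x3)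
      - b * (b - (l + 1 - c) * x3) - (x3 ^ 3 - b * x3 ^ 2) = x3 * (x * x3 - b * l)"
    unfolding x3_def by Groebner_Basis.algebra
  also have "x * x3 - b * l = 0"
    using 4(3) by (simp add: x3_def)
  finally have "(b - (l + 1 - c) * x3) ^ 2 + (1 - c) * x3 * (b - (l + 1 - c) * x3)
      - b * (b - (l + 1 - c) * x3) = x3 ^ 3 - b * x3 ^ 2"
    by simp
  then show ?thesis
    unfolding 4(1) using 4(2) by (simp add: tate_add_origin Affine_mem_tate x3_def)
qed

text \<open>The points \<open>P\<close>, \<open>Q\<close> and \<open>- (P + Q)\<close> are collinear, so the line through \<open>P\<close> and
  \<open>- (P + Q)\<close> leads back to \<open>Q\<close>. This is the only instance of associativity that is needed.\<close>

lemma tate_add_origin_cancel: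
  assumes "b \<noteq> 0" "Q \<in> points (tate b c)"
  shows "point_add (tate b c) (Affine 0 0) (tate_neg b c (point_add (tate b c) (Affine 0 0) Q)) =
    tate_neg b c Q"
  using assms(2)
proof (cases rule: tate_point_cases)
  case 2
  then show ?thesis
    using assms(1) by (simp add: tate_double_origin tate_add_origin algebra_simps)
next
  case (4 x l)
  define x3 where "x3 = l ^ 2 + (1 - c) * l + b - x"
  have R: "tate_neg b c (point_add (tate b c) (Affine 0 0) Q) = Affine x3 (l * x3)"
    unfolding 4(1) using 4(2) by (simp add: tate_add_origin flip: x3_def) (simp add: algebra_simps)
  show ?thesis
  proof (cases "x3 = 0")
    case True
    then have "l = 0"
      using 4(3) assms(1) by (simp flip: x3_def)
    then show ?thesis
      unfolding R using True 4(1) assms(1)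
      by (simp add: tate_double_origin) (simp add: x3_def algebra_simps)
  next
    case False
    then show ?thesis
      unfolding R using 4(1) by (simp add: tate_add_origin) (simp add: x3_def algebra_simps)
  qed
qed (simp_all add: tate_add_origin_neg)

lemma point_mult_0 [simp]: "point_mult E 0 P = Infinity"
  and point_mult_Suc [simp]: "point_mult E (Suc n) P = point_add E P (point_mult E n P)"
  by (simp_all add: point_mult_def)

lemma tate_mult_origin_mem:
  assumes "b \<noteq> 0"
  shows "point_mult (tate b c) n (Affine 0 0) \<in> points (tate b c)"
proof (induction n)
  case 0
  then show ?case
    by (simp add: points_def)
next
  case (Suc n)
  then show ?case
    using tate_add_origin_mem[OF assms] by simp
qed

text \<open>Adding the origin P to \<open>- (n - k) P\<close> gives \<open>- (n - k - 1) P\<close>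
  by cancellation. By induction the former is \<open>k P\<close>, so the sum is also
  \<open>(k + 1) P\<close>.\<close>

lemma tate_mult_origin_diff:
  assumes "b \<noteq> 0" "point_mult (tate b c) n (Affine 0 0) = Infinity" "k \<le> n"
  shows "point_mult (tate b c) (n - k) (Affine 0 0) =
    tate_neg b c (point_mult (tate b c) k (Affine 0 0))"
  using assms(3)
proof (induction k)
  case 0
  then show ?case
    using assms(2) by simp
next
  case (Suc k)
  let ?M = "\<lambda>k. point_mult (tate b c) k (Affine 0 0)"
  have "?M (n - k) = point_add (tate b c) (Affine 0 0) (?M (n - Suc k))"
    using Suc.prems by (metis Suc_diff_Suc Suc_le_lessD point_mult_Suc)
  then have "point_add (tate b c) (Affine 0 0) (tate_neg b c (?M (n - k))) =
      tate_neg b c (?M (n - Suc k))"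
    using tate_add_origin_cancel[OF assms(1) tate_mult_origin_mem[OF assms(1)]] by metis
  moreover have "tate_neg b c (?M (n - k)) = ?M k"
    using Suc by (simp add: tate_neg_neg)
  ultimately have "?M (Suc k) = tate_neg b c (?M (n - Suc k))"
    by simp
  then show ?case
    by (simp only: tate_neg_neg)
qed

lemma point_mult_transform:
  assumes "change_of_variables u r s t E (tate b c)" "u \<noteq> 0" "b \<noteq> 0"
  shows "point_mult E n (Affine r t) =
    transform_point u r s t (point_mult (tate b c) n (Affine 0 0))"
proof (induction n)
  case (Suc n)
  have "point_add E (transform_point u r s t (Affine 0 0))
      (transform_point u r s t (point_mult (tate b c) n (Affine 0 0))) =
    transform_point u r s t (point_mult (tate b c) (Suc n) (Affine 0 0))"
    using point_add_transform[OF assms(1,2) _ tate_mult_origin_mem[OF assms(3)], of "Affine 0 0"]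
    by (simp add: Affine_mem_tate)
  then show ?case
    using Suc by simp
qed simp

section \<open>Normal form and the parameter of a point of order 12\<close>

text \<open>Translating the point to the origin removes \<open>a6\<close>, shearing by the tangent
  slope \<open>s\<close> removes \<open>a4\<close>, and scaling makes \<open>a2\<close> and
  \<open>a3\<close> equal. The last step needs both to be nonzero: \<open>a3\<close> vanishes only
  if \<open>2 P\<close> is zero, and \<open>a2\<close> only if \<open>3 P\<close> is zero.\<close>

lemma tate_normal_form:
  assumes P: "Affine x y \<in> points E"
    and 2: "point_mult E 2 (Affine x y) \<noteq> Infinity" and 3: "point_mult E 3 (Affine x y) \<noteq> Infinity"
  obtains u s b c where "u \<noteq> 0" "b \<noteq> 0" "change_of_variables u x s y E (tate b c)"
proof -
  define \<alpha>3 where "\<alpha>3 = 2 * y + a1 E * x + a3 E"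
  define s where "s = (3 * x ^ 2 + 2 * a2 E * x + a4 E - a1 E * y) / \<alpha>3"
  define \<alpha>2 where "\<alpha>2 = a2 E - s * a1 E + 3 * x - s ^ 2"
  have \<alpha>3: "\<alpha>3 \<noteq> 0"
    using 2 by (auto simp: numeral_2_eq_2 \<alpha>3_def point_add.simps(3))
  have s: "s * \<alpha>3 = 3 * x ^ 2 + 2 * a2 E * x + a4 E - a1 E * y"
    using \<alpha>3 by (simp add: s_def)
  have "point_add E (Affine x y) (Affine x y) =
      Affine (x - \<alpha>2) (- (s + a1 E) * (x - \<alpha>2) - (y - s * x) - a3 E)"
  proof -
    have "s ^ 2 + a1 E * s - a2 E - x - x = x - \<alpha>2"
      by (simp add: \<alpha>2_def algebra_simps)
    then show ?thesis
      using \<alpha>3 by (simp add: point_add.simps(3) s_def \<alpha>3_def Let_def)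
  qed
  \<comment> \<open>If \<alpha>2 were zero, the double computed above would be \<open>- P\<close>,
    and \<open>3 P\<close> would be zero.\<close>
  moreover have "point_add E (Affine x y) (Affine x (- (s + a1 E) * x - (y - s * x) - a3 E)) = Infinity"
    by (simp add: point_add.simps(3) algebra_simps)
  ultimately have \<alpha>2: "\<alpha>2 \<noteq> 0"
    using 3 by (auto simp: numeral_3_eq_3)
  \<comment> \<open>This scale solves \<open>\<alpha>2 / u ^ 2 = \<alpha>3 / u ^ 3\<close>; the
    common value is \<open>- b\<close>.\<close>
  define u where "u = \<alpha>3 / \<alpha>2"
  define b where "b = - \<alpha>3 / u ^ 3"
  define c where "c = 1 - (a1 E + 2 * s) / u"
  have u: "u \<noteq> 0" and b: "b \<noteq> 0"
    using \<alpha>2 \<alpha>3 by (simp_all add: u_def b_def)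
  have "u ^ 2 * - b = \<alpha>2"
    using u \<alpha>2 \<alpha>3 by (simp add: b_def eval_nat_numeral) (simp add: u_def)
  moreover have "u ^ 3 * - b = \<alpha>3" "u * (1 - c) = a1 E + 2 * s"
    using u by (simp_all add: b_def c_def)
  moreover have "a4 E - s * a3 E + 2 * x * a2 E - (y + x * s) * a1 E + 3 * x ^ 2 - 2 * s * y = 0"
    using s unfolding \<alpha>3_def by (simp add: algebra_simps)
  moreover have "a6 E + x * a4 E + x ^ 2 * a2 E + x ^ 3 - y * a3 E - y ^ 2 - x * y * a1 E = 0"
    using P by (simp add: points_def algebra_simps)
  ultimately have "change_of_variables u x s y E (tate b c)"
    by (simp add: change_of_variables_def tate_def \<alpha>2_def \<alpha>3_def algebra_simps)
  then show thesis
    using that u b by blast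
qed

text \<open>The multiples up to \<open>6 P\<close> are computed in successively adapted parameters.
  The condition \<open>6 P = - 6 P\<close> then becomes linear in \<open>e\<close>, so it defines a
  curve with a rational parametrisation.\<close>

lemma tate_order_12:
  assumes b: "b \<noteq> 0"
    and fin: "point_mult (tate b c) 12 (Affine 0 0) = Infinity"
    and ord: "\<And>n. \<lbrakk>0 < n; n < 12\<rbrakk> \<Longrightarrow> point_mult (tate b c) n (Affine 0 0) \<noteq> Infinity"
  obtains v where "v \<noteq> 0" "v \<noteq> 1" "v \<noteq> - 1"
    "c = (v ^ 2 + v + 1) * (v ^ 2 + v) / (1 - v)" "b = c * ((v ^ 2 + 1) / (1 - v))"
proof -
  let ?P = "Affine 0 0" and ?T = "tate b c"
  let ?M = "\<lambda>n. point_mult ?T n ?P"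
  have step: "?M (Suc n) = Affine X Y"
    if "?M n = Affine x y" "x \<noteq> 0" "y = l * x" "X = l ^ 2 + (1 - c) * l + b - x"
      "Y = b - (l + 1 - c) * X" for n x y l X Y
    using that by (simp add: tate_add_origin)
  \<comment> \<open>The point \<open>(0, b)\<close> is \<open>- P\<close>, so reaching it at
    \<open>n P\<close> would make \<open>(n + 1) P\<close> zero. Applied to \<open>3 P\<close>,
    \<open>4 P\<close> and \<open>5 P\<close>, this excludes \<open>c = 0\<close>,
    \<open>d = 1\<close> and \<open>e = 1\<close>.\<close>
  have not_neg: "?M n \<noteq> Affine 0 b" if "0 < n" "n < 11" for n
    using ord[of "Suc n"] that by (auto simp: tate_add_origin_neg)
  have M2: "?M 2 = Affine b (b * c)"
    using tate_double_origin[OF b] by (simp add: numeral_2_eq_2)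
  have M3: "?M 3 = Affine c (b - c)"
    using step[OF M2 b, of c c "b - c"] by (simp add: algebra_simps power2_eq_square)
  have c: "c \<noteq> 0"
    using M3 not_neg[of 3] by auto
  define d where "d = b / c"
  have bd: "b = c * d"
    using c by (simp add: d_def)
  have M4: "?M 4 = Affine (d * (d - 1)) (d ^ 2 * (c - d + 1))"
    using step[OF M3 c, of "d - 1" "d * (d - 1)" "d ^ 2 * (c - d + 1)"]
    by (simp add: bd algebra_simps power2_eq_square)
  have d0: "d \<noteq> 0"
    using b bd by auto
  have d1: "d \<noteq> 1"
    using M4 not_neg[of 4] bd by auto
  define e where "e = c / (d - 1)"
  have ce: "c = e * (d - 1)"
    using d1 by (simp add: e_def)
  have e0: "e \<noteq> 0"
    using c ce by auto
  have M5: "?M 5 = Affine (d * e * (e - 1)) (d * e ^ 2 * (d - e))"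
    using step[OF M4, of "d * (e - 1)" "d * e * (e - 1)" "d * e ^ 2 * (d - e)"] d0 d1
    by (simp add: bd ce algebra_simps power2_eq_square)
  have e1: "e \<noteq> 1"
    using M5 not_neg[of 5] bd ce by auto
  \<comment> \<open>Chosen so that \<open>- (e * \<tau>)\<close> is the slope of the chord through P
    and \<open>5 P\<close>.\<close>
  define \<tau> where "\<tau> = (e - d) / (e - 1)"
  have "\<tau> * (e - 1) = e - d"
    using e1 by (simp add: \<tau>_def)
  then have d\<tau>: "d = e - \<tau> * (e - 1)"
    by simp
  have \<tau>1: "\<tau> \<noteq> 1"
    using d\<tau> d1 by auto
  define x6 y6 where "x6 = e * \<tau> * (\<tau> - 1)"
    and "y6 = e ^ 2 * (\<tau> - 1) ^ 2 * (\<tau> - (e - 1) * (\<tau> - 1))"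
  have M6: "?M 6 = Affine x6 y6"
  proof -
    have six: "6 = Suc 5"
      by simp
    have "d * e * (e - 1) \<noteq> 0"
      using d0 e0 e1 by simp
    moreover have "d * e ^ 2 * (d - e) = - (e * \<tau>) * (d * e * (e - 1))"
      unfolding d\<tau> by Groebner_Basis.algebra
    moreover have "x6 = (- (e * \<tau>)) ^ 2 + (1 - c) * (- (e * \<tau>)) + b - d * e * (e - 1)"
      unfolding x6_def bd ce d\<tau> by Groebner_Basis.algebra
    moreover have "y6 = b - (- (e * \<tau>) + 1 - c) * x6"
      unfolding y6_def x6_def bd ce d\<tau> by Groebner_Basis.algebra
    ultimately show ?thesis
      unfolding six by (rule step[OF M5])
  qed
  have "?M 6 = tate_neg b c (?M 6)"
    using tate_mult_origin_diff[OF b fin, of 6] by simp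
  then have "y6 = b - (1 - c) * x6 - y6"
    unfolding M6 by simp
  then have "2 * y6 + (1 - c) * x6 - b = 0"
    by (simp add: algebra_simps)
  moreover have "2 * y6 + (1 - c) * x6 - b =
      e ^ 2 * (\<tau> - 1) * (\<tau> * (2 * \<tau> - 1) - (e - 1) * (\<tau> - 1) ^ 2)"
    unfolding x6_def y6_def bd ce d\<tau> by Groebner_Basis.algebra
  ultimately have rel: "(e - 1) * (\<tau> - 1) ^ 2 = \<tau> * (2 * \<tau> - 1)"
    using e0 \<tau>1 by simp
  \<comment> \<open>The relation gives \<open>e - 1\<close> as the product of
    \<open>\<tau> / (\<tau> - 1)\<close> and \<open>(2 * \<tau> - 1) / (\<tau> - 1)\<close>; these
    factors differ by 1, so they are \<open>v\<close> and \<open>v + 1\<close>.\<close>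
  define v where "v = \<tau> / (\<tau> - 1)"
  have v1: "v - 1 = 1 / (\<tau> - 1)"
    using \<tau>1 by (simp add: v_def field_simps)
  then have v_ne_1: "v \<noteq> 1"
    using \<tau>1 by auto
  have \<tau>: "\<tau> = v / (v - 1)"
    using \<tau>1 by (simp add: v1) (simp add: v_def)
  have "e - 1 = \<tau> * (2 * \<tau> - 1) / (\<tau> - 1) ^ 2"
    using rel \<tau>1 by (simp add: field_simps)
  also have "\<dots> = v * (v + 1)"
    using \<tau>1 by (simp add: v_def power2_eq_square field_simps)
  finally have ev: "e - 1 = v * (v + 1)" .
  then have "v \<noteq> 0" "v \<noteq> - 1"
    using e1 by auto
  have "d = 1 + (1 - \<tau>) * (e - 1)"
    by (simp add: d\<tau> algebra_simps)
  also have "1 - \<tau> = 1 / (1 - v)"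
    using v_ne_1 by (simp add: \<tau> field_simps)
  finally have d: "d = (v ^ 2 + 1) / (1 - v)" "d - 1 = (v ^ 2 + v) / (1 - v)"
    using v_ne_1 by (simp_all add: ev power2_eq_square field_simps)
  have e: "e = v ^ 2 + v + 1"
    using ev by (simp add: algebra_simps power2_eq_square)
  show thesis
  proof
    show "c = (v ^ 2 + v + 1) * (v ^ 2 + v) / (1 - v)"
      unfolding ce d(2) e by simp
    show "b = c * ((v ^ 2 + 1) / (1 - v))"
      using bd d(1) by simp
  qed fact+
qed

section \<open>Integral models of the curves with a point of order 12\<close>

lemma integral_model_descend:
  assumes "integral_model E (Weierstrass (d * X) (d ^ 2 * Y) (d ^ 3 * Z) 0 0)" "d \<noteq> 0"
  shows "integral_model E (Weierstrass X Y Z 0 0)"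
  using isomorphic_rescale[OF assms(1)[unfolded integral_model_def, simplified], of "1 / of_int d"]
    assms(2)
  by (simp add: integral_model_def power_divide)

text \<open>At \<open>3\<close> these curves have additive, potentially multiplicative reduction.\<close>

lemma bad_reduction_at_3:
  assumes "integral_model E (Weierstrass (3 * X) (3 * Y) (9 * Z) 0 0)" "\<not> 3 dvd Y"
  shows "\<not> good_reduction E 3"
proof (rule bad_reduction_if_j_not_integral[OF _ assms(1), where n = 7])
  \<comment> \<open>The exponent 7 is just large enough: \<open>c4\<close> is 9 times an integer
    \<open>C\<close> congruent to \<open>Y ^ 2\<close> modulo 3, so \<open>c4 ^ 3\<close> contains 3
    exactly six times.\<close>
  have "discriminant (Weierstrass (3 * X) (3 * Y) (9 * Z) 0 0) = 3 ^ 7 *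
      (- ((3 * X ^ 2 + 4 * Y) ^ 2 * Y * Z ^ 2) - 72 * X ^ 3 * Z ^ 3 - 81 * Z ^ 4
        + 27 * (3 * X ^ 2 + 4 * Y) * X * Z ^ 3)"
    by (simp add: discriminant_def b2_def b4_def b6_def b8_def) Groebner_Basis.algebra
  then show "int 3 ^ 7 dvd discriminant (Weierstrass (3 * X) (3 * Y) (9 * Z) 0 0)"
    by simp
  define C where "C = (3 * X ^ 2 + 4 * Y) ^ 2 - 72 * X * Z"
  have "C = Y ^ 2 + 3 * (3 * X ^ 4 + 8 * X ^ 2 * Y + 5 * Y ^ 2 - 24 * X * Z)"
    unfolding C_def by Groebner_Basis.algebra
  moreover have "\<not> 3 dvd Y ^ 2"
    using assms(2) prime_dvd_power[of 3 Y 2] by auto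
  ultimately have "\<not> 3 dvd C"
    by (simp only: dvd_add_left_iff[OF dvd_triv_left] not_False_eq_True)
  then have "\<not> 3 dvd C ^ 3"
    by (simp add: prime_dvd_power_iff)
  moreover have "c4 (Weierstrass (3 * X) (3 * Y) (9 * Z) 0 0) ^ 3 = 3 ^ 6 * C ^ 3"
  proof -
    have "c4 (Weierstrass (3 * X) (3 * Y) (9 * Z) 0 0) = 9 * C"
      by (simp add: c4_def b2_def b4_def C_def) Groebner_Basis.algebra
    then show ?thesis
      by (simp add: power_mult_distrib)
  qed
  moreover have "(3::int) ^ 7 = 3 ^ 6 * 3"
    by simp
  ultimately show "\<not> int 3 ^ 7 dvd c4 (Weierstrass (3 * X) (3 * Y) (9 * Z) 0 0) ^ 3"
    by (metis dvd_mult_cancel_left of_nat_numeral power_not_zero zero_neq_numeral)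
qed simp

text \<open>The Tate normal form with parameter \<open>v = m / k\<close>, rescaled by \<open>k^3 (m - k)\<close>.\<close>

definition model12 :: "int \<Rightarrow> int \<Rightarrow> int weierstrass" where
  "model12 m k = (let f = m ^ 2 + m * k + k ^ 2; g = m ^ 2 + k ^ 2 in
     Weierstrass (k ^ 3 * (m - k) + f * m * (m + k)) (- (k ^ 2 * f * g * m * (m + k)))
       (- (k ^ 5 * (m - k) * f * g * m * (m + k))) 0 0)"

lemma tate_order_12_integral_model:
  fixes v :: rat
  assumes iso: "isomorphic E (tate b c)" and v: "v \<noteq> 0" "v \<noteq> 1" "v \<noteq> - 1"
    and c: "c = (v ^ 2 + v + 1) * (v ^ 2 + v) / (1 - v)" and b: "b = c * ((v ^ 2 + 1) / (1 - v))"
  obtains m k where "coprime m k" "m \<noteq> 0" "k \<noteq> 0" "m \<noteq> k" "m \<noteq> - k"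
    "integral_model E (model12 m k)"
proof -
  obtain m k where mk: "quotient_of v = (m, k)"
    by fastforce
  then have k: "k > 0" and cop: "coprime m k" and vmk: "v = of_int m / of_int k"
    by (simp_all add: quotient_of_denom_pos quotient_of_coprime quotient_of_div)
  define M K :: rat where "M = of_int m" and "K = of_int k"
  have K: "K \<noteq> 0" and vMK: "v = M / K"
    using k vmk by (simp_all add: M_def K_def)
  have n: "M - K \<noteq> 0"
    using v(2) K vMK by auto
  \<comment> \<open>This is a denominator of \<open>c\<close>. The denominator
    \<open>w * K * (M - K)\<close> of \<open>b\<close> divides \<open>w ^ 2\<close>, so scaling by
    \<open>w\<close> makes all coefficients integral.\<close>
  define w where "w = K ^ 3 * (M - K)"
  have w: "w \<noteq> 0"
    using K n by (simp add: w_def)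
  define f g where "f = M ^ 2 + M * K + K ^ 2" and "g = M ^ 2 + K ^ 2"
  have v1: "1 - v = - (M - K) / K"
    using K by (simp add: vMK field_simps)
  have "c = (f / K ^ 2) * (M * (M + K) / K ^ 2) / (- (M - K) / K)"
    unfolding c v1 using K by (simp add: vMK f_def power2_eq_square add_divide_distrib algebra_simps)
  then have c': "c = - (f * M * (M + K)) / w"
    using K n by (simp add: w_def eval_nat_numeral divide_simps) Groebner_Basis.algebra
  have "b = c * ((g / K ^ 2) / (- (M - K) / K))"
    unfolding b v1 using K by (simp add: vMK g_def power2_eq_square add_divide_distrib)
  then have b': "b = f * g * M * (M + K) / (w * K * (M - K))"
    unfolding c' using K n w by (simp add: eval_nat_numeral divide_simps) Groebner_Basis.algebra
  have "w * (1 - c) = K ^ 3 * (M - K) + f * M * (M + K)"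
    unfolding w_def[symmetric] c' using w by (simp add: field_simps)
  moreover have "w ^ 2 * b = K ^ 2 * f * g * M * (M + K)"
    using w K n by (simp add: b' power2_eq_square) (simp add: w_def eval_nat_numeral)
  moreover have "w ^ 3 * b = K ^ 5 * (M - K) * f * g * M * (M + K)"
    using w K n by (simp add: b' power3_eq_cube) (simp add: w_def eval_nat_numeral)
  ultimately have "integral_model E (model12 m k)"
    using isomorphic_rescale[OF iso[unfolded tate_def] w]
    by (simp add: integral_model_def model12_def M_def K_def f_def g_def Let_def)
  moreover have "m \<noteq> 0" "m \<noteq> k" "m \<noteq> - k"
    using v k vmk by auto
  ultimately show thesis
    using that cop k by auto
qed

section \<open>Bad primes of the integral models\<close>

text \<open>The divisibility hypotheses concern \<open>a3\<close> and \<open>a2\<close>. Once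
  \<open>p\<close> divides \<open>a2\<close>, the quantity \<open>a1 ^ 2 + 4 * a2\<close> is
  \<open>a1 ^ 2\<close> modulo \<open>p\<close>, so only \<open>a1\<close> has to be
  inspected.\<close>

lemma bad_reduction_model12:
  assumes "integral_model E (model12 m k)" "prime p"
    and dvd: "int p dvd k ^ 5 * (m - k) * (m ^ 2 + m * k + k ^ 2) * (m ^ 2 + k ^ 2) * m * (m + k)"
      "int p dvd k ^ 2 * (m ^ 2 + m * k + k ^ 2) * (m ^ 2 + k ^ 2) * m * (m + k)"
    and a1: "\<not> int p dvd k ^ 3 * (m - k) + (m ^ 2 + m * k + k ^ 2) * m * (m + k)"
  shows "\<not> good_reduction E p"
proof (rule bad_reduction_if_a3_dvd[OF assms(2)])
  show "integral_model E (Weierstrass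
      (k ^ 3 * (m - k) + (m ^ 2 + m * k + k ^ 2) * m * (m + k))
      (- (k ^ 2 * (m ^ 2 + m * k + k ^ 2) * (m ^ 2 + k ^ 2) * m * (m + k)))
      (- (k ^ 5 * (m - k) * (m ^ 2 + m * k + k ^ 2) * (m ^ 2 + k ^ 2) * m * (m + k))) 0 0)"
    using assms(1) by (simp add: model12_def Let_def)
next
  have "prime (int p)"
    using assms(2) by simp
  then have "\<not> int p dvd (k ^ 3 * (m - k) + (m ^ 2 + m * k + k ^ 2) * m * (m + k)) ^ 2"
    using a1 prime_dvd_power by blast
  moreover have "int p dvd
      4 * (- (k ^ 2 * (m ^ 2 + m * k + k ^ 2) * (m ^ 2 + k ^ 2) * m * (m + k)))"
    using dvd(2) by simp
  ultimately show "\<not> int p dvd (k ^ 3 * (m - k) + (m ^ 2 + m * k + k ^ 2) * m * (m + k)) ^ 2 +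
      4 * (- (k ^ 2 * (m ^ 2 + m * k + k ^ 2) * (m ^ 2 + k ^ 2) * m * (m + k)))"
    by (simp only: dvd_add_left_iff) simp
qed (use dvd(1) in simp)

text \<open>Modulo \<open>p\<close> the coefficient \<open>a1\<close> is \<open>- k^4\<close>, \<open>m^4\<close>, \<open>- 2 k^4\<close> and \<open>- 2 k^4\<close>,
  respectively.\<close>

lemma bad_reduction_model12_cusp:
  assumes E: "integral_model E (model12 m k)" and p: "prime p" and mk: "coprime m k"
    and "int p dvd m \<or> int p dvd k \<or> p \<noteq> 2 \<and> (int p dvd m + k \<or> int p dvd m ^ 2 + k ^ 2)"
  shows "\<not> good_reduction E p"
proof -
  let ?a = "k ^ 3 * (m - k) + (m ^ 2 + m * k + k ^ 2) * m * (m + k)"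
  have p': "prime (int p)"
    using p by simp
  have ndvd: "\<not> (int p dvd m \<and> int p dvd k)"
    using mk p' by (meson coprime_common_divisor not_prime_unit)
  have p2: "\<not> int p dvd 2" if "p \<noteq> 2"
    using that p by (metis int_dvd_int_iff of_nat_numeral primes_dvd_imp_eq two_is_prime_nat)
  consider "int p dvd m" | "int p dvd k" | "p \<noteq> 2" "int p dvd m + k"
    | "p \<noteq> 2" "int p dvd m ^ 2 + k ^ 2"
    using assms(4) by blast
  then show ?thesis
  proof cases
    case 1
    have "?a = m * (k ^ 3 + (m ^ 2 + m * k + k ^ 2) * (m + k)) - k ^ 4"
      by Groebner_Basis.algebra
    moreover have "\<not> int p dvd k ^ 4"
      using ndvd 1 p' prime_dvd_power by blast
    ultimately have "\<not> int p dvd ?a"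
      using 1 by (simp add: dvd_diff_right_iff)
    then show ?thesis
      using bad_reduction_model12[OF E p] 1 by simp
  next
    case 2
    have "?a = m ^ 4 + k * (k ^ 2 * (m - k) + 2 * m ^ 3 + 2 * m ^ 2 * k + m * k ^ 2)"
      by Groebner_Basis.algebra
    moreover have "\<not> int p dvd m ^ 4"
      using ndvd 2 p' prime_dvd_power by blast
    ultimately have "\<not> int p dvd ?a"
      using 2 by (simp add: dvd_add_left_iff)
    moreover have "int p dvd k ^ 5" "int p dvd k ^ 2"
      using 2 by (meson dvd_power dvd_trans zero_less_numeral)+
    ultimately show ?thesis
      using bad_reduction_model12[OF E p] by simp
  next
    case 3
    have "?a = (m + k) * (k ^ 3 + (m ^ 2 + m * k + k ^ 2) * m) - 2 * k ^ 4"
      by Groebner_Basis.algebra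
    moreover have "\<not> int p dvd k"
      using ndvd 3 by (metis dvd_add_left_iff)
    then have "\<not> int p dvd 2 * k ^ 4"
      using p2[OF 3(1)] p' by (meson prime_dvd_mult_iff prime_dvd_power)
    ultimately have "\<not> int p dvd ?a"
      using 3 by (simp add: dvd_diff_right_iff)
    then show ?thesis
      using bad_reduction_model12[OF E p] 3 by simp
  next
    case 4
    have "?a = (m ^ 2 + k ^ 2) * (m + k) ^ 2 - 2 * k ^ 4"
      by Groebner_Basis.algebra
    moreover have "\<not> int p dvd k"
    proof
      assume k: "int p dvd k"
      then have "int p dvd m ^ 2"
        using 4(2) by (simp add: dvd_add_left_iff power2_eq_square)
      then show False
        using ndvd k p' prime_dvd_power by blast
    qed
    then have "\<not> int p dvd 2 * k ^ 4"
      using p2[OF 4(1)] p' by (meson prime_dvd_mult_iff prime_dvd_power)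
    ultimately have "\<not> int p dvd ?a"
      using 4 by (simp add: dvd_diff_right_iff)
    then show ?thesis
      using bad_reduction_model12[OF E p] 4 by simp
  qed
qed

text \<open>For odd \<open>m\<close> and \<open>k\<close> the model is not minimal at 2:
  \<open>a1\<close>, \<open>a2\<close>, \<open>a3\<close> are divisible by 2, 4, 8. Scaling this
  factor away leaves an odd \<open>a1\<close> and an even \<open>a3\<close>.\<close>

lemma bad_reduction_model12_at_2:
  assumes E: "integral_model E (model12 m k)" and mk: "coprime m k"
  shows "\<not> good_reduction E 2"
proof (cases "even m \<or> even k")
  case True
  then show ?thesis
    using bad_reduction_model12_cusp[OF E _ mk, of 2] by simp
next
  case False
  then have "even (m - k)"
    by simp
  then obtain j where "m - k = 2 * j"
    by blast
  then have m: "m = k + 2 * j"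
    by simp
  have k: "odd k"
    using False by simp
  define f where "f = m ^ 2 + m * k + k ^ 2"
  define g where "g = k ^ 2 + 2 * j * k + 2 * j ^ 2"
  define X Y Z where "X = k ^ 3 * j + f * m * (k + j)"
    and "Y = - (k ^ 2 * f * g * m * (k + j))"
    and "Z = - (k ^ 5 * j * f * g * m * (k + j))"
  have "model12 m k = Weierstrass (2 * X) (2 ^ 2 * Y) (2 ^ 3 * Z) 0 0"
  proof -
    have eqs: "m ^ 2 + k ^ 2 = 2 * g" "m - k = 2 * j" "m + k = 2 * (k + j)"
      by (simp_all add: m g_def algebra_simps power2_eq_square)
    show ?thesis
      unfolding model12_def Let_def f_def[symmetric] eqs X_def Y_def Z_def
      by (simp add: algebra_simps)
  qed
  then have "integral_model E (Weierstrass X Y Z 0 0)"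
    using E integral_model_descend[of E 2 X Y Z] by simp
  moreover have "odd f"
    using k False by (simp add: f_def)
  \<comment> \<open>Modulo 2, \<open>X\<close> is \<open>j + (k + j)\<close>, hence 1, and one of
    \<open>j\<close> and \<open>k + j\<close> is even because \<open>k\<close> is odd.\<close>
  then have "odd X" "even Z"
    using k False by (auto simp: X_def Z_def)
  ultimately show ?thesis
    using bad_reduction_if_a3_dvd[of 2 E X Y Z] by simp
qed

text \<open>If 3 divides none of \<open>m\<close>, \<open>k\<close>, \<open>m + k\<close>, then
  \<open>m\<close> and \<open>k\<close> agree modulo 3, and 3 divides both \<open>m - k\<close> and
  \<open>m ^ 2 + m * k + k ^ 2\<close>. This gives the shape treated in
  \<open>bad_reduction_at_3\<close>.\<close>

lemma bad_reduction_model12_at_3: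
  assumes E: "integral_model E (model12 m k)" and mk: "coprime m k"
  shows "\<not> good_reduction E 3"
proof (cases "3 dvd m \<or> 3 dvd k \<or> 3 dvd m + k")
  case True
  then show ?thesis
    using bad_reduction_model12_cusp[OF E _ mk, of 3] by auto
next
  case False
  then have "3 dvd m - k"
    by presburger
  then obtain j where "m - k = 3 * j"
    by blast
  then have m: "m = k + 3 * j"
    by simp
  define f where "f = k ^ 2 + 3 * j * k + 3 * j ^ 2"
  define g where "g = m ^ 2 + k ^ 2"
  define X Y Z where "X = k ^ 3 * j + f * m * (m + k)"
    and "Y = - (k ^ 2 * f * g * m * (m + k))"
    and "Z = - (k ^ 5 * j * f * g * m * (m + k))"
  have "model12 m k = Weierstrass (3 * X) (3 * Y) (9 * Z) 0 0"
  proof -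
    have "m ^ 2 + m * k + k ^ 2 = 3 * f" "m - k = 3 * j"
      by (simp_all add: m f_def algebra_simps power2_eq_square)
    then show ?thesis
      by (simp add: model12_def X_def Y_def Z_def Let_def flip: g_def)
  qed
  moreover have "\<not> 3 dvd Y"
  proof -
    have "\<not> 3 dvd k ^ 2"
      using False by (simp add: prime_dvd_power_iff)
    \<comment> \<open>Modulo 3, \<open>f\<close> is \<open>k ^ 2\<close> and \<open>g\<close> is
      \<open>2 * k ^ 2\<close>.\<close>
    moreover have "f = k ^ 2 + 3 * (j * k + j ^ 2)" "g = 2 * k ^ 2 + 3 * (2 * j * k + 3 * j ^ 2)"
      by (simp_all add: f_def g_def m algebra_simps power2_eq_square)
    ultimately have "\<not> 3 dvd f" "\<not> 3 dvd g"
      by (simp_all add: dvd_add_left_iff prime_dvd_mult_iff)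
    then show ?thesis
      using False by (simp add: Y_def prime_dvd_mult_iff prime_dvd_power_iff)
  qed
  ultimately show ?thesis
    using bad_reduction_at_3 E by metis
qed

section \<open>A bad prime other than 2 and 3\<close>

lemma sum_of_squares_prime_divisor:
  fixes m k :: int
  assumes mk: "coprime m k" and "m \<noteq> 0" "k \<noteq> 0" "m \<noteq> k" "m \<noteq> - k"
  obtains p where "prime p" "p \<noteq> 2" "p \<noteq> 3" "int p dvd m ^ 2 + k ^ 2"
proof -
  \<comment> \<open>A sum of two odd squares is 2 modulo 4, so a single halving already yields the
    odd part.\<close>
  define g where "g = (if even (m ^ 2 + k ^ 2) then (m ^ 2 + k ^ 2) div 2 else m ^ 2 + k ^ 2)"
  have "(if even N then N div 2 else N) dvd N" for N :: int
    by (auto elim!: evenE)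
  then have g_dvd: "g dvd m ^ 2 + k ^ 2"
    unfolding g_def by blast
  have "odd g"
  proof (cases "even (m ^ 2 + k ^ 2)")
    case True
    then have "odd m" "odd k"
      using mk by (auto dest: coprime_common_divisor[of m k 2])
    then obtain i j where "m = 2 * i + 1" "k = 2 * j + 1"
      by (meson oddE)
    then have "m ^ 2 + k ^ 2 = 2 * (2 * (i ^ 2 + i + j ^ 2 + j) + 1)"
      by (simp add: algebra_simps power2_eq_square)
    then have "g = 2 * (i ^ 2 + i + j ^ 2 + j) + 1"
      by (simp add: g_def)
    then show ?thesis
      by simp
  qed (simp add: g_def)
  have "m ^ 2 + k ^ 2 > 2"
  proof -
    have "m ^ 2 \<ge> 1" "k ^ 2 \<ge> 1"
      using assms(2,3) by (simp_all add: int_one_le_iff_zero_less)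
    \<comment> \<open>This excludes \<open>1 + 1 = 2\<close>, whose odd part has no prime
      factor.\<close>
    moreover have "m ^ 2 \<noteq> k ^ 2"
      using assms(4,5) by (simp add: power2_eq_iff)
    ultimately show ?thesis
      by linarith
  qed
  moreover have "2 < N \<Longrightarrow> 1 < (if even N then N div 2 else N)" for N :: int
    by presburger
  ultimately have "g > 1"
    unfolding g_def by blast
  then have "nat g \<noteq> 1"
    by linarith
  then obtain p where p: "prime p" "p dvd nat g"
    using prime_factor_nat by blast
  then have pg: "int p dvd g"
    using p(2) \<open>g > 1\<close> by (simp flip: int_dvd_int_iff)
  have "p \<noteq> 2"
    using pg \<open>odd g\<close> by auto
  moreover have "p \<noteq> 3"
  proof
    assume "p = 3"
    then have "3 dvd m ^ 2 + k ^ 2"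
      using pg g_dvd by (metis dvd_trans of_nat_numeral)
    then have sum: "(m ^ 2 mod 3 + k ^ 2 mod 3) mod 3 = 0"
      by (simp only: mod_add_eq dvd_eq_mod_eq_0)
    \<comment> \<open>Since squares are 0 or 1 modulo 3, two of them sum to 0 only if both are
      0.\<close>
    have square: "x ^ 2 mod 3 = (if 3 dvd x then 0 else 1)" for x :: int
    proof -
      have "x mod 3 = 0 \<or> x mod 3 = 1 \<or> x mod 3 = 2"
        by presburger
      then show ?thesis
        unfolding power_mod[of x 3 2, symmetric] dvd_eq_mod_eq_0 by (elim disjE) simp_all
    qed
    have "3 dvd m \<and> 3 dvd k"
      using sum unfolding square by (auto split: if_splits)
    then show False
      using mk by (auto dest: coprime_common_divisor[of m k 3])
  qed
  moreover have "int p dvd m ^ 2 + k ^ 2"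
    using pg g_dvd by (rule dvd_trans)
  ultimately show thesis
    using that p(1) by blast
qed

section \<open>The conductor and the contradiction\<close>

lemma bad_reduction_dvd_conductor:
  assumes "conductor E \<noteq> 1" "prime p" "\<not> good_reduction E p"
  shows "p dvd conductor E"
proof -
  let ?S = "{p. prime p \<and> conductor_exponent E p \<noteq> 0}"
  \<comment> \<open>a product over an infinite set would be \<open>1\<close>\<close>
  have "finite ?S"
    using assms(1) unfolding conductor_def by (meson prod.infinite)
  moreover have "conductor_exponent E p \<noteq> 0"
    using assms(3) by (simp add: conductor_exponent_def)
  ultimately have "p ^ conductor_exponent E p dvd conductor E"
    unfolding conductor_def using assms(2) by (intro dvd_prodI) auto
  with \<open>conductor_exponent E p \<noteq> 0\<close> show ?thesis
    by (meson dvd_power_iff_le dvd_trans dvd_power bot_nat_0.not_eq_extremum)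
qed

lemma order_12_integral_model:
  fixes E :: "rat weierstrass"
  assumes "P \<in> points E" "has_order E P 12"
  obtains m k where "coprime m k" "m \<noteq> 0" "k \<noteq> 0" "m \<noteq> k" "m \<noteq> - k"
    "integral_model E (model12 m k)"
proof -
  have fin: "point_mult E 12 P = Infinity"
    and ord: "\<And>n. \<lbrakk>0 < n; n < 12\<rbrakk> \<Longrightarrow> point_mult E n P \<noteq> Infinity"
    using assms(2) by (auto simp: has_order_def)
  have "P \<noteq> Infinity"
    using ord[of 1] by auto
  then obtain x y where P: "P = Affine x y"
    by (meson point.exhaust)
  obtain u s b c where u: "u \<noteq> 0" and b: "b \<noteq> 0"
      and cov: "change_of_variables u x s y E (tate b c)"
  proof (rule tate_normal_form)
    show "Affine x y \<in> points E"
      using assms(1) P by simp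
    show "point_mult E 2 (Affine x y) \<noteq> Infinity" "point_mult E 3 (Affine x y) \<noteq> Infinity"
      using ord[of 2] ord[of 3] P by simp_all
  qed
  \<comment> \<open>The change of variables carries the origin to P, so both points have the same
    vanishing multiples.\<close>
  have inf: "point_mult (tate b c) n (Affine 0 0) = Infinity \<longleftrightarrow> point_mult E n P = Infinity" for n
    unfolding P point_mult_transform[OF cov u b] by (simp add: transform_point_eq_Infinity_iff)
  obtain v where v: "v \<noteq> 0" "v \<noteq> 1" "v \<noteq> - 1"
    "c = (v ^ 2 + v + 1) * (v ^ 2 + v) / (1 - v)" "b = c * ((v ^ 2 + 1) / (1 - v))"
    using tate_order_12[OF b] fin ord unfolding inf[symmetric] by metis
  have "isomorphic E (tate b c)"
    using u cov unfolding isomorphic_def by blast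
  then show thesis
    using tate_order_12_integral_model[OF _ v] that by metis
qed

theorem theorem3p10:
  shows "\<not> (\<exists>E :: rat weierstrass. elliptic_curve E \<and>
      (\<exists>P \<in> points E. has_order E P 12) \<and>
      (\<exists>(p::nat) (q::nat) (\<alpha>::nat) (\<beta>::nat). prime p \<and> prime q \<and> p \<noteq> q \<and>
         \<alpha> > 0 \<and> \<beta> > 0 \<and> conductor E = p ^ \<alpha> * q ^ \<beta>))"
proof (clarify)
  fix E :: "rat weierstrass" and P and p q \<alpha> \<beta> :: nat
  assume P: "P \<in> points E" "has_order E P 12"
    and pq: "prime p" "prime q" "0 < \<alpha>" "0 < \<beta>" and N: "conductor E = p ^ \<alpha> * q ^ \<beta>"
  \<comment> \<open>This ensures that the product defining the conductor ranges over a finite set of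
    primes.\<close>
  have N1: "conductor E \<noteq> 1"
    using pq by (auto simp: N)
  have bad: "r = p \<or> r = q" if "prime r" "\<not> good_reduction E r" for r
    using bad_reduction_dvd_conductor[OF N1 that] that(1) pq
    by (auto simp: N prime_dvd_mult_iff prime_dvd_power_iff primes_dvd_imp_eq)
  obtain m k where mk: "coprime m k" "m \<noteq> 0" "k \<noteq> 0" "m \<noteq> k" "m \<noteq> - k"
      and E: "integral_model E (model12 m k)"
    using order_12_integral_model[OF P] .
  obtain r where r: "prime r" "r \<noteq> 2" "r \<noteq> 3" "int r dvd m ^ 2 + k ^ 2"
    using sum_of_squares_prime_divisor[OF mk] .
  then have "\<not> good_reduction E r"
    using bad_reduction_model12_cusp[OF E r(1) mk(1)] by blast
  then show False
    using bad[of 2] bad[of 3] bad[of r] r(1,2,3)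
      bad_reduction_model12_at_2[OF E mk(1)] bad_reduction_model12_at_3[OF E mk(1)] by auto
qed

end
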